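(* Let $n\ge 1$ and $m$ be integers, let $c_{rs}$ ($1\le r\le n$, $1\le s\le 2$) be complex numbers, and let $\Psi_0,\Psi_1:\mathbb{Z}\to\mathbb{C}$ be given functions. Consider the linear partial difference equation $$U_{i+m,j+2}=\sum_{s=1}^{2}\sum_{r=1}^{n}c_{rs}\,U_{i+(r-1),\,j+(s-1)}\qquad (i\in\mathbb{Z},\ j\in\mathbb{N}\cup\{0\})$$ for an unknown function $U:\mathbb{Z}\times(\mathbb{N}\cup\{0\})\to\mathbb{C}$, $(i,j)\mapsto U_{i,j}$, with the initial conditions $U_{i,t}=\Psi_t(i)$ for all $i\in\mathbb{Z}$ and $t=0,1$. For a family $l=(l_{rs})_{1\le r\le n,\,1\le s\le 2}$ of nonnegative integers and $j\in\mathbb{N}\cup\{0\}$ put $$R(l)=\sum_{s=1}^{2}\sum_{r=1}^{n}r\,l_{rs},\qquad N_1(l)=\frac{j+\sum_{s=1}^{2}\sum_{r=1}^{n}s\,l_{rs}}{3},\qquad N_2(l)=\frac{j-1+\sum_{s=1}^{2}\sum_{r=1}^{n}s\,l_{rs}}{3},$$ and for $q\in\{1,2\}$ let $I_q$ be the set of all such families $l$ with $0\le l_{rs}\le N_q(l)$ for all $r,s$ and $\sum_{s=1}^{2}\sum_{r=1}^{n}l_{rs}=N_q(l)$. Then the solution is given, for all $i\in\mathbb{Z}$ and $j\in\mathbb{N}\cup\{0\}$, by $$\begin{aligned}U_{i,j}={}&\sum_{l\in I_{1}}\binom{N_1(l)}{l_{11},l_{12},\dots,l_{n2}}\Big(\prod_{s=1}^{2}\prod_{r=1}^{n}c_{rs}^{l_{rs}}\Big)\Psi_{0}\big(i+R(l)-(m+1)N_1(l)\big)\\&+\sum_{l\in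 I_{2}}\binom{N_2(l)}{l_{11},l_{12},\dots,l_{n2}}\Big(\prod_{s=1}^{2}\prod_{r=1}^{n}c_{rs}^{l_{rs}}\Big)\Psi_{1}\big(i+R(l)-(m+1)N_2(l)\big)\\&-\sum_{e=1}^{n}c_{e2}\sum_{l\in I_{2}}\binom{N_2(l)}{l_{11},l_{12},\dots,l_{n2}}\Big(\prod_{s=1}^{2}\prod_{r=1}^{n}c_{rs}^{l_{rs}}\Big)\Psi_{0}\big(i+e-1-m+R(l)-(m+1)N_2(l)\big).\end{aligned}$$
   Context: $\mathbb{N}=\{1,2,\dots\}$. The symbol $\binom{N}{l_{11},l_{12},\dots,l_{n2}}=\frac{N!}{\prod_{r,s}l_{rs}!}$ (for nonnegative integers $l_{rs}$ with $\sum_{r,s}l_{rs}=N$) is the multinomial coefficient. An empty sum is $0$, and the convention $0^0=1$ is used in powers of coefficients. *)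

theory Defs
  imports Complex_Main "HOL-Library.FuncSet"
begin

definition solves_ivp ::
  "nat \<Rightarrow> int \<Rightarrow> (nat \<Rightarrow> nat \<Rightarrow> complex) \<Rightarrow> (int \<Rightarrow> complex) \<Rightarrow> (int \<Rightarrow> complex) \<Rightarrow>
    (int \<Rightarrow> nat \<Rightarrow> complex) \<Rightarrow> bool" where
  "solves_ivp n m c \<Psi>0 \<Psi>1 U \<longleftrightarrow>
     (\<forall>i j. U (i + m) (j + 2) =
        (\<Sum>s=1..2. \<Sum>r=1..n. c r s * U (i + (int r - 1)) (j + (s - 1)))) \<and>
     (\<forall>i. U i 0 = \<Psi>0 i) \<and> (\<forall>i. U i 1 = \<Psi>1 i)"

text \<open>A family \<open>(l\<^sub>r\<^sub>s)\<close> is a function on pairs \<open>(r, s)\<close>, extensional on the index set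
  (that is, \<open>undefined\<close> off it), so that distinct functions are distinct families.\<close>

definition families :: "nat \<Rightarrow> (nat \<times> nat \<Rightarrow> nat) set" where
  "families n = ({1..n} \<times> {1..2}) \<rightarrow>\<^sub>E UNIV"

definition R :: "nat \<Rightarrow> (nat \<times> nat \<Rightarrow> nat) \<Rightarrow> nat" where
  "R n l = (\<Sum>s=1..2. \<Sum>r=1..n. r * l (r, s))"

text \<open>\<open>N1\<close> and \<open>N2\<close> are the exact quotients, real-valued: for a general family they are not
  integers, and \<open>N2\<close> may be negative.\<close>

definition N1 :: "nat \<Rightarrow> nat \<Rightarrow> (nat \<times> nat \<Rightarrow> nat) \<Rightarrow> real" where
  "N1 n j l = (real j + (\<Sum>s=1..2. \<Sum>r=1..n. real s * real (l (r, s)))) / 3"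

definition N2 :: "nat \<Rightarrow> nat \<Rightarrow> (nat \<times> nat \<Rightarrow> nat) \<Rightarrow> real" where
  "N2 n j l = (real j - 1 + (\<Sum>s=1..2. \<Sum>r=1..n. real s * real (l (r, s)))) / 3"

definition index_set ::
  "nat \<Rightarrow> ((nat \<times> nat \<Rightarrow> nat) \<Rightarrow> real) \<Rightarrow> (nat \<times> nat \<Rightarrow> nat) set" where
  "index_set n N = {l \<in> families n.
     (\<forall>r\<in>{1..n}. \<forall>s\<in>{1..2}. real (l (r, s)) \<le> N l) \<and>
     (\<Sum>s=1..2. \<Sum>r=1..n. real (l (r, s))) = N l}"

abbreviation I1 :: "nat \<Rightarrow> nat \<Rightarrow> (nat \<times> nat \<Rightarrow> nat) set" where
  "I1 n j \<equiv> index_set n (N1 n j)"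

abbreviation I2 :: "nat \<Rightarrow> nat \<Rightarrow> (nat \<times> nat \<Rightarrow> nat) set" where
  "I2 n j \<equiv> index_set n (N2 n j)"

text \<open>On the index sets, \<open>N\<close> takes natural number values, so the floors below (needed only for
  typing) are exact.\<close>

definition multinom :: "nat \<Rightarrow> real \<Rightarrow> (nat \<times> nat \<Rightarrow> nat) \<Rightarrow> complex" where
  "multinom n N l = fact (nat \<lfloor>N\<rfloor>) / (\<Prod>s=1..2. \<Prod>r=1..n. fact (l (r, s)))"

definition shift :: "nat \<Rightarrow> int \<Rightarrow> real \<Rightarrow> (nat \<times> nat \<Rightarrow> nat) \<Rightarrow> int" where
  "shift n m N l = int (R n l) - (m + 1) * \<lfloor>N\<rfloor>"

definition coeff_prod :: "nat \<Rightarrow> (nat \<Rightarrow> nat \<Rightarrow> complex) \<Rightarrow> (nat \<times> nat \<Rightarrow> nat) \<Rightarrow> complex" where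
  "coeff_prod n c l = (\<Prod>s=1..2. \<Prod>r=1..n. c r s ^ l (r, s))"

text \<open>Sums over infinite sets are \<open>0\<close> by convention; the next two lemmas show that this
  does not affect sums over \<open>I1\<close> and \<open>I2\<close>.\<close>

lemma finite_index_set:
  assumes "\<And>l. N l \<le> (real j + (\<Sum>s=1..2. \<Sum>r=1..n. real s * real (l (r, s)))) / 3"
  shows "finite (index_set n N)"
proof (rule finite_subset)
  show "finite (({1..n} \<times> {1..2::nat}) \<rightarrow>\<^sub>E {..j})"
    by (intro finite_PiE) auto
  show "index_set n N \<subseteq> ({1..n} \<times> {1..2::nat}) \<rightarrow>\<^sub>E {..j}"
  proof
    fix l assume l: "l \<in> index_set n N"
    let ?S = "\<Sum>s=1..2::nat. \<Sum>r=1..n. real (l (r, s))"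
    have "(\<Sum>s=1..2. \<Sum>r=1..n. real s * real (l (r, s))) \<le>
        (\<Sum>s=1..2::nat. \<Sum>r=1..n. 2 * real (l (r, s)))"
      by (intro sum_mono mult_right_mono) auto
    also have "\<dots> = 2 * ?S"
      by (simp add: sum_distrib_left)
    finally have "N l \<le> (real j + 2 * ?S) / 3"
      by (intro order_trans[OF assms[of l]] divide_right_mono add_left_mono) auto
    moreover have S: "?S = N l"
      using l by (simp add: index_set_def)
    ultimately have Nj: "N l \<le> real j"
      by (simp add: S field_simps)
    have "l (r, s) \<le> j" if "r \<in> {1..n}" "s \<in> {1..2}" for r s
    proof -
      have "real (l (r, s)) \<le> N l"
        using l that by (simp add: index_set_def)
      then show ?thesis using Nj by linarith
    qed
    then show "l \<in> ({1..n} \<times> {1..2::nat}) \<rightarrow>\<^sub>E {..j}"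
      using l unfolding index_set_def families_def PiE_iff by blast
  qed
qed

lemma finite_I1: "finite (I1 n j)"
  by (rule finite_index_set[where j = j]) (simp add: N1_def)

lemma finite_I2: "finite (I2 n j)"
  by (rule finite_index_set[where j = j]) (simp add: N2_def)

end

theory Submission
  imports Defs
begin

text \<open>
  Write \<open>T\<close> for the translation \<open>(T f) i = f (i + 1)\<close> of functions on the integers and put
  \<open>A = (\<Sum>r. c r 1 * T\<^sup>r\<^sup>-\<^sup>1\<^sup>-\<^sup>m)\<close> and \<open>B = (\<Sum>r. c r 2 * T\<^sup>r\<^sup>-\<^sup>1\<^sup>-\<^sup>m)\<close>. The equation then reads
  \<open>U\<^sub>j\<^sub>+\<^sub>2 = A U\<^sub>j + B U\<^sub>j\<^sub>+\<^sub>1\<close>, a two-term recurrence with commuting coefficients. Let \<open>F\<^sub>j\<close> be the sum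
  of all words in the \<open>2n\<close> summands of \<open>A\<close> and \<open>B\<close> of total weight \<open>j\<close>, where the summands of
  \<open>A\<close> weigh \<open>2\<close> and those of \<open>B\<close> weigh \<open>1\<close>. Splitting off the first letter of a word gives
  \<open>F\<^sub>j\<^sub>+\<^sub>2 = A F\<^sub>j + B F\<^sub>j\<^sub>+\<^sub>1\<close>, with \<open>F\<^sub>0 = 1\<close>, \<open>F\<^sub>1 = B\<close> and \<open>F\<^sub>-\<^sub>1 = 0\<close>. Hence
  \<open>F\<^sub>j \<Psi>0 + F\<^sub>j\<^sub>-\<^sub>1 \<Psi>1 - B F\<^sub>j\<^sub>-\<^sub>1 \<Psi>0\<close> satisfies the recurrence and takes the values \<open>\<Psi>0\<close> and \<open>\<Psi>1\<close> at
  \<open>j = 0\<close> and \<open>j = 1\<close>, and two consecutive values determine a solution.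

  Since the letters commute, words with the same letter counts \<open>l\<close> coincide; there are
  multinomially many of them, and each has weight \<open>\<Sum> (3 - s) * l (r, s)\<close>. The condition
  \<open>\<Sum> l (r, s) = N1 n j l\<close> that defines \<open>I1 n j\<close> says precisely that this weight is \<open>j\<close>, and
  \<open>I2 n j\<close> is the same set for the weight \<open>j - 1\<close>. Splitting off a letter becomes Pascal's
  rule for multinomial coefficients (\<open>multinomial_pascal\<close>), which yields the recurrence for
  \<open>F\<close> in \<open>expansion_rec\<close>.
\<close>

section \<open>Multinomial expansions over families of given weight\<close>

definition weighted_families :: "'a set \<Rightarrow> ('a \<Rightarrow> nat) \<Rightarrow> nat \<Rightarrow> ('a \<Rightarrow> nat) set" where
  "weighted_families K w j = {l \<in> K \<rightarrow>\<^sub>E UNIV. (\<Sum>p\<in>K. w p * l p) = j}"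

definition multinomial :: "'a set \<Rightarrow> ('a \<Rightarrow> nat) \<Rightarrow> complex" where
  "multinomial K l = fact (\<Sum>p\<in>K. l p) / (\<Prod>p\<in>K. fact (l p))"

text \<open>With \<open>T\<close> the unit translation, this is \<open>F\<^sub>j f\<close> for the letters \<open>c p * T\<^bsup>d p\<^esup>\<close> of weight
  \<open>w p\<close>, that is, the sum of the products of all words of weight \<open>j\<close>, applied to \<open>f\<close>.\<close>

definition expansion ::
  "'a set \<Rightarrow> ('a \<Rightarrow> nat) \<Rightarrow> ('a \<Rightarrow> complex) \<Rightarrow> ('a \<Rightarrow> int) \<Rightarrow> (int \<Rightarrow> complex) \<Rightarrow> nat \<Rightarrow> int \<Rightarrow> complex"
where
  "expansion K w c d f j i =
     (\<Sum>l\<in>weighted_families K w j.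
        multinomial K l * (\<Prod>p\<in>K. c p ^ l p) * f (i + (\<Sum>p\<in>K. int (l p) * d p)))"

lemma finite_weighted_families:
  assumes "finite K" "\<And>p. p \<in> K \<Longrightarrow> w p > 0"
  shows "finite (weighted_families K w j)"
proof (rule finite_subset)
  show "finite (K \<rightarrow>\<^sub>E {..j})"
    using assms(1) by (intro finite_PiE) auto
  show "weighted_families K w j \<subseteq> K \<rightarrow>\<^sub>E {..j}"
  proof
    fix l assume l: "l \<in> weighted_families K w j"
    have "l p \<le> j" if "p \<in> K" for p
    proof -
      have "l p \<le> w p * l p" using assms(2)[OF that] by simp
      also have "\<dots> \<le> (\<Sum>p\<in>K. w p * l p)"
        using that assms(1) by (intro member_le_sum) auto
      finally show ?thesis using l by (simp add: weighted_families_def)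
    qed
    then show "l \<in> K \<rightarrow>\<^sub>E {..j}"
      using l by (auto simp: weighted_families_def PiE_iff)
  qed
qed

lemma sum_fun_upd_Suc:
  fixes g :: "'a \<Rightarrow> nat \<Rightarrow> 'b::comm_monoid_add"
  assumes "finite K" "p \<in> K" "g p (Suc (l p)) = x + g p (l p)"
  shows "(\<Sum>q\<in>K. g q ((l(p := Suc (l p))) q)) = x + (\<Sum>q\<in>K. g q (l q))"
proof -
  have "(\<Sum>q\<in>K. g q ((l(p := Suc (l p))) q)) = g p (Suc (l p)) + (\<Sum>q\<in>K - {p}. g q (l q))"
    using assms(1,2) by (subst sum.remove[of _ p]) (auto intro!: arg_cong2[of _ _ _ _ "(+)"] sum.cong)
  then show ?thesis
    using assms by (simp add: sum.remove[of K p "\<lambda>q. g q (l q)"] add.assoc)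
qed

lemma prod_fun_upd_Suc:
  fixes g :: "'a \<Rightarrow> nat \<Rightarrow> 'b::comm_monoid_mult"
  assumes "finite K" "p \<in> K" "g p (Suc (l p)) = x * g p (l p)"
  shows "(\<Prod>q\<in>K. g q ((l(p := Suc (l p))) q)) = x * (\<Prod>q\<in>K. g q (l q))"
proof -
  have "(\<Prod>q\<in>K. g q ((l(p := Suc (l p))) q)) = g p (Suc (l p)) * (\<Prod>q\<in>K - {p}. g q (l q))"
    using assms(1,2) by (subst prod.remove[of _ p]) (auto intro!: arg_cong2[of _ _ _ _ "(*)"] prod.cong)
  then show ?thesis
    using assms by (simp add: prod.remove[of K p "\<lambda>q. g q (l q)"] mult.assoc)
qed

text \<open>Among all words with given letter counts, those that begin with \<open>p\<close> form a proportion equal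
  to the count of \<open>p\<close> divided by the length. Here \<open>l\<close> counts the letters that remain after the
  initial \<open>p\<close>.\<close>

lemma multinomial_fun_upd_Suc:
  assumes "finite K" "p \<in> K"
  shows "of_nat (Suc (l p)) * multinomial K (l(p := Suc (l p))) =
         of_nat (Suc (\<Sum>q\<in>K. l q)) * multinomial K l"
proof -
  have s: "(\<Sum>q\<in>K. (l(p := Suc (l p))) q) = Suc (\<Sum>q\<in>K. l q)"
    using sum_fun_upd_Suc[OF assms, of "\<lambda>_ k. k" l 1] by simp
  have pr: "(\<Prod>q\<in>K. fact ((l(p := Suc (l p))) q) :: complex) =
      of_nat (Suc (l p)) * (\<Prod>q\<in>K. fact (l q))"
    by (rule prod_fun_upd_Suc[OF assms]) simp
  have "of_nat (Suc (l p)) \<noteq> (0::complex)"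
    by (simp only: of_nat_eq_0_iff nat.simps not_False_eq_True)
  then show ?thesis
    unfolding multinomial_def s pr fact_Suc by (simp del: of_nat_Suc)
qed

text \<open>The proportions of the words with the various first letters add up to \<open>1\<close>.\<close>

lemma multinomial_pascal:
  assumes K: "finite K" and pos: "(\<Sum>p\<in>K. l p) > 0"
  shows "multinomial K l = (\<Sum>p | p \<in> K \<and> l p > 0. multinomial K (l(p := l p - 1)))"
proof -
  let ?N = "\<Sum>p\<in>K. l p"
  have "of_nat ?N * (\<Sum>p | p \<in> K \<and> l p > 0. multinomial K (l(p := l p - 1))) =
        (\<Sum>p | p \<in> K \<and> l p > 0. of_nat (l p) * multinomial K l)"
    unfolding sum_distrib_left
  proof (rule sum.cong[OF refl])
    fix p assume p: "p \<in> {p \<in> K. l p > 0}"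
    let ?l = "l(p := l p - 1)"
    have l: "?l(p := Suc (?l p)) = l" using p by auto
    have "(\<Sum>q\<in>K. (?l(p := Suc (?l p))) q) = 1 + (\<Sum>q\<in>K. ?l q)"
      by (rule sum_fun_upd_Suc[OF K]) (use p in auto)
    then have N: "?N = Suc (\<Sum>q\<in>K. ?l q)"
      unfolding l by simp
    have "l p = Suc (?l p)" using p by simp
    then show "of_nat ?N * multinomial K ?l = of_nat (l p) * multinomial K l"
      using multinomial_fun_upd_Suc[OF K, of p ?l] p unfolding l N by simp
  qed
  also have "\<dots> = (\<Sum>p\<in>K. of_nat (l p) * multinomial K l)"
    using K by (intro sum.mono_neutral_left) auto
  also have "\<dots> = of_nat ?N * multinomial K l"
    by (simp add: sum_distrib_right)
  finally show ?thesis
    using pos by (subst (asm) mult_cancel_left) (simp del: of_nat_sum)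
qed

text \<open>The words that begin with the letter \<open>p\<close> contribute \<open>c p * T\<^bsup>d p\<^esup>\<close> times the words of
  weight \<open>j - w p\<close>; no such words exist if \<open>w p > j\<close>.\<close>

lemma expansion_rec:
  assumes K: "finite K" and w: "\<And>p. p \<in> K \<Longrightarrow> w p > 0" and j: "j > 0"
  shows "expansion K w c d f j i =
    (\<Sum>p\<in>K. if w p \<le> j then c p * expansion K w c d f (j - w p) (i + d p) else 0)"
proof -
  define t where "t l = (\<Prod>p\<in>K. c p ^ l p) * f (i + (\<Sum>p\<in>K. int (l p) * d p))" for l
  let ?S = "weighted_families K w"
  have "expansion K w c d f j i =
      (\<Sum>l\<in>?S j. \<Sum>p | p \<in> K \<and> l p > 0. multinomial K (l(p := l p - 1)) * t l)"
    unfolding expansion_def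
  proof (rule sum.cong[OF refl])
    fix l assume "l \<in> ?S j"
    then have "(\<Sum>p\<in>K. w p * l p) \<noteq> 0"
      using j by (simp add: weighted_families_def)
    then have "(\<Sum>p\<in>K. l p) > 0"
      using K by (metis (no_types, lifting) gr0I mult_0_right sum.neutral sum_eq_0_iff)
    then show "multinomial K l * (\<Prod>p\<in>K. c p ^ l p) * f (i + (\<Sum>p\<in>K. int (l p) * d p)) =
        (\<Sum>p | p \<in> K \<and> l p > 0. multinomial K (l(p := l p - 1)) * t l)"
      by (subst multinomial_pascal[OF K]) (simp_all add: t_def sum_distrib_right mult.assoc)
  qed
  also have "\<dots> = (\<Sum>p\<in>K. \<Sum>l | l \<in> ?S j \<and> l p > 0. multinomial K (l(p := l p - 1)) * t l)"
    by (rule sum.swap_restrict[OF finite_weighted_families[OF K w] K])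
  also have "\<dots> = (\<Sum>p\<in>K. if w p \<le> j then c p * expansion K w c d f (j - w p) (i + d p) else 0)"
  proof (rule sum.cong[OF refl])
    fix p assume p: "p \<in> K"
    let ?up = "\<lambda>l. l(p := Suc (l p))"
    have weight: "(\<Sum>q\<in>K. w q * ?up l q) = w p + (\<Sum>q\<in>K. w q * l q)" for l
      by (rule sum_fun_upd_Suc[OF K p]) simp
    have up_down: "?up (l(p := l p - 1)) = l" if "l p > 0" for l
      using that by auto
    show "(\<Sum>l | l \<in> ?S j \<and> l p > 0. multinomial K (l(p := l p - 1)) * t l) =
        (if w p \<le> j then c p * expansion K w c d f (j - w p) (i + d p) else 0)"
    proof (cases "w p \<le> j")
      case True
      have "(\<Sum>l | l \<in> ?S j \<and> l p > 0. multinomial K (l(p := l p - 1)) * t l) =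
          (\<Sum>l\<in>?S (j - w p). multinomial K l * t (?up l))"
      proof (rule sum.reindex_bij_witness[where j = "\<lambda>l. l(p := l p - 1)" and i = ?up])
        fix l assume "l \<in> {l. l \<in> ?S j \<and> l p > 0}"
        then have l: "l \<in> ?S j" "l p > 0" by auto
        show "l(p := l p - 1) \<in> ?S (j - w p)"
          using l p weight[of "l(p := l p - 1)"] up_down[of l, OF l(2)]
          by (auto simp: weighted_families_def PiE_iff extensional_def)
      next
        fix l assume l: "l \<in> ?S (j - w p)"
        show "?up l \<in> {l. l \<in> ?S j \<and> l p > 0}"
          using l p True weight[of l]
          by (auto simp: weighted_families_def PiE_iff extensional_def)
      qed (use up_down in auto)
      also have "\<dots> = c p * expansion K w c d f (j - w p) (i + d p)"
        unfolding expansion_def sum_distrib_left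
      proof (rule sum.cong[OF refl])
        fix l
        have "(\<Prod>q\<in>K. c q ^ ?up l q) = c p * (\<Prod>q\<in>K. c q ^ l q)"
          by (rule prod_fun_upd_Suc[OF K p]) simp
        moreover have "(\<Sum>q\<in>K. int (?up l q) * d q) = d p + (\<Sum>q\<in>K. int (l q) * d q)"
          by (rule sum_fun_upd_Suc[OF K p]) (simp add: algebra_simps)
        ultimately show "multinomial K l * t (?up l) = c p * (multinomial K l *
            (\<Prod>p\<in>K. c p ^ l p) * f (i + d p + (\<Sum>p\<in>K. int (l p) * d p)))"
          by (simp only: t_def) (simp add: algebra_simps)
      qed
      finally show ?thesis using True by simp
    next
      case False
      have "\<not> (l \<in> ?S j \<and> l p > 0)" for l
      proof
        assume l: "l \<in> ?S j \<and> l p > 0"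
        then have "w p \<le> (\<Sum>q\<in>K. w q * l q)"
          using weight[of "l(p := l p - 1)"] unfolding up_down[of l, OF conjunct2[OF l]] by linarith
        then show False
          using l False by (simp add: weighted_families_def)
      qed
      then show ?thesis using False by (simp only: Collect_empty_eq[THEN iffD2]) simp
    qed
  qed
  finally show ?thesis .
qed

lemma weighted_families_0:
  assumes "finite K" "\<And>p. p \<in> K \<Longrightarrow> w p > 0"
  shows "weighted_families K w 0 = {\<lambda>p\<in>K. 0}"
  using assms by (fastforce simp: weighted_families_def PiE_iff extensional_def fun_eq_iff)

lemma expansion_0:
  assumes "finite K" "\<And>p. p \<in> K \<Longrightarrow> w p > 0"
  shows "expansion K w c d f 0 i = f i"
  by (simp add: expansion_def weighted_families_0[OF assms] multinomial_def)

section \<open>The recurrence and its solutions\<close>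

definition recurrent ::
  "nat \<Rightarrow> int \<Rightarrow> (nat \<Rightarrow> nat \<Rightarrow> complex) \<Rightarrow> (int \<Rightarrow> nat \<Rightarrow> complex) \<Rightarrow> bool" where
  "recurrent n m c X \<longleftrightarrow> (\<forall>i j. X (i + m) (j + 2) =
     (\<Sum>s=1..2. \<Sum>r=1..n. c r s * X (i + (int r - 1)) (j + (s - 1))))"

lemma recurrent_add:
  "recurrent n m c X \<Longrightarrow> recurrent n m c Y \<Longrightarrow> recurrent n m c (\<lambda>i j. X i j + Y i j)"
  unfolding recurrent_def by (simp add: distrib_left sum.distrib)

lemma recurrent_diff:
  "recurrent n m c X \<Longrightarrow> recurrent n m c Y \<Longrightarrow> recurrent n m c (\<lambda>i j. X i j - Y i j)"
  unfolding recurrent_def by (simp add: right_diff_distrib sum_subtractf)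

lemma recurrent_scale:
  "recurrent n m c X \<Longrightarrow> recurrent n m c (\<lambda>i j. a * X i j)"
  unfolding recurrent_def by (simp add: sum_distrib_left mult.left_commute)

lemma recurrent_translate:
  assumes "recurrent n m c X"
  shows "recurrent n m c (\<lambda>i j. X (i + k) j)"
  unfolding recurrent_def
proof (intro allI)
  fix i j
  show "X (i + m + k) (j + 2) =
      (\<Sum>s=1..2. \<Sum>r=1..n. c r s * X (i + (int r - 1) + k) (j + (s - 1)))"
    using assms[unfolded recurrent_def, rule_format, of "i + k" j] by (simp add: algebra_simps)
qed

lemma recurrent_sum:
  assumes "\<And>e. e \<in> E \<Longrightarrow> recurrent n m c (X e)"
  shows "recurrent n m c (\<lambda>i j. \<Sum>e\<in>E. X e i j)"
  using assms
proof (induction E rule: infinite_finite_induct)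
  case (insert x F)
  then show ?case by (simp add: recurrent_add)
qed (simp_all add: recurrent_def)

lemma solves_ivp_unique:
  assumes "solves_ivp n m c \<Psi>0 \<Psi>1 U" "solves_ivp n m c \<Psi>0 \<Psi>1 V"
  shows "U i j = V i j"
proof (induction j arbitrary: i rule: less_induct)
  case (less j)
  consider "j = 0" | "j = 1" | k where "j = k + 2"
    by (metis One_nat_def add_2_eq_Suc' not0_implies_Suc)
  then show ?case
  proof cases
    case 3
    have rec: "X (i - m + m) (k + 2) =
        (\<Sum>s=1..2. \<Sum>r=1..n. c r s * X (i - m + (int r - 1)) (k + (s - 1)))"
      if "solves_ivp n m c \<Psi>0 \<Psi>1 X" for X
      using that unfolding solves_ivp_def by blast
    have "U (i - m + m) (k + 2) = V (i - m + m) (k + 2)"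
      unfolding rec[OF assms(1)] rec[OF assms(2)]
      using 3 by (intro sum.cong arg_cong2[of _ _ _ _ "(*)"] less.IH) auto
    then show ?thesis using 3 by simp
  qed (use assms in \<open>auto simp: solves_ivp_def\<close>)
qed

section \<open>The index sets as families of given weight\<close>

abbreviation indices :: "nat \<Rightarrow> (nat \<times> nat) set" where
  "indices n \<equiv> {1..n} \<times> {1..2}"

text \<open>A step with the coefficient \<open>c r s\<close> relates the levels \<open>j + 2\<close> and \<open>j + s - 1\<close>, hence
  raises the level by \<open>3 - s\<close>.\<close>

definition level_weight :: "nat \<times> nat \<Rightarrow> nat" where
  "level_weight p = 3 - snd p"

definition displacement :: "int \<Rightarrow> nat \<times> nat \<Rightarrow> int" where
  "displacement m p = int (fst p) - 1 - m"

lemma level_weight_pos: "p \<in> indices n \<Longrightarrow> level_weight p > 0"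
  by (auto simp: level_weight_def)

lemma sum_indices:
  "(\<Sum>s=1..2. \<Sum>r=1..n. g r s) = (\<Sum>p\<in>indices n. g (fst p) (snd p))"
  by (subst sum.swap) (simp add: sum.cartesian_product case_prod_beta)

lemma prod_indices:
  "(\<Prod>s=1..2. \<Prod>r=1..n. g r s) = (\<Prod>p\<in>indices n. g (fst p) (snd p))"
  by (subst prod.swap) (simp add: prod.cartesian_product case_prod_beta)

text \<open>Clearing the denominator in \<open>\<Sum> l (r, s) = (k + \<Sum> s * l (r, s)) / 3\<close> leaves
  \<open>k = \<Sum> (3 - s) * l (r, s)\<close>. The individual bounds on the \<open>l (r, s)\<close> follow from the equation
  for their sum.\<close>

lemma index_set_iff:
  assumes "\<And>l. N l = (k + (\<Sum>s=1..2. \<Sum>r=1..n. real s * real (l (r, s)))) / 3"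
  shows "l \<in> index_set n N \<longleftrightarrow>
    l \<in> indices n \<rightarrow>\<^sub>E UNIV \<and> real (\<Sum>p\<in>indices n. level_weight p * l p) = k"
proof -
  let ?S = "\<Sum>p\<in>indices n. real (l p)"
  have "real (\<Sum>p\<in>indices n. level_weight p * l p) =
      (\<Sum>p\<in>indices n. 3 * real (l p) - real (snd p) * real (l p))"
    unfolding of_nat_sum
    by (rule sum.cong) (auto simp: level_weight_def of_nat_diff algebra_simps)
  also have "\<dots> = 3 * ?S - (\<Sum>p\<in>indices n. real (snd p) * real (l p))"
    by (simp add: sum_subtractf sum_distrib_left)
  finally have eq: "?S = N l \<longleftrightarrow> real (\<Sum>p\<in>indices n. level_weight p * l p) = k"
    unfolding assms sum_indices by (simp add: field_simps) linarith
  have "real (l p) \<le> ?S" if "p \<in> indices n" for p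
    using that by (intro member_le_sum) auto
  then show ?thesis
    unfolding index_set_def families_def eq[symmetric] sum_indices by auto
qed

lemma I1_eq: "I1 n j = weighted_families (indices n) level_weight j"
  unfolding set_eq_iff weighted_families_def
  by (simp add: index_set_iff[where k = "real j" and N = "N1 n j", OF N1_def] del: of_nat_sum)

lemma N2_Suc: "N2 n (Suc j) = N1 n j"
  by (rule ext) (simp add: N1_def N2_def)

lemma I2_0: "I2 n 0 = {}"
proof -
  have "l \<notin> I2 n 0" for l
    by (subst index_set_iff[where k = "real 0 - 1", OF N2_def]) (simp del: of_nat_sum)
  then show ?thesis by blast
qed

lemma N1_eq:
  assumes "l \<in> I1 n j"
  shows "N1 n j l = real (\<Sum>p\<in>indices n. l p)"
  using assms unfolding index_set_def sum_indices by simp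

definition expansion1 ::
  "nat \<Rightarrow> int \<Rightarrow> (nat \<Rightarrow> nat \<Rightarrow> complex) \<Rightarrow> (int \<Rightarrow> complex) \<Rightarrow> int \<Rightarrow> nat \<Rightarrow> complex" where
  "expansion1 n m c f i j =
     (\<Sum>l\<in>I1 n j. multinom n (N1 n j l) l * coeff_prod n c l * f (i + shift n m (N1 n j l) l))"

definition expansion2 ::
  "nat \<Rightarrow> int \<Rightarrow> (nat \<Rightarrow> nat \<Rightarrow> complex) \<Rightarrow> (int \<Rightarrow> complex) \<Rightarrow> int \<Rightarrow> nat \<Rightarrow> complex" where
  "expansion2 n m c f i j =
     (\<Sum>l\<in>I2 n j. multinom n (N2 n j l) l * coeff_prod n c l * f (i + shift n m (N2 n j l) l))"

lemma expansion1_eq: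
  "expansion1 n m c f i j =
   expansion (indices n) level_weight (\<lambda>p. c (fst p) (snd p)) (displacement m) f j i"
  unfolding expansion1_def expansion_def I1_eq[symmetric]
proof (rule sum.cong[OF refl])
  fix l assume l: "l \<in> I1 n j"
  have floor_N: "\<lfloor>N1 n j l\<rfloor> = int (\<Sum>p\<in>indices n. l p)"
    unfolding N1_eq[OF l] by (rule floor_of_nat)
  have "multinom n (N1 n j l) l = multinomial (indices n) l"
    unfolding multinom_def multinomial_def floor_N prod_indices by (simp del: of_nat_sum)
  moreover have "coeff_prod n c l = (\<Prod>p\<in>indices n. c (fst p) (snd p) ^ l p)"
    unfolding coeff_prod_def prod_indices by simp
  moreover have "shift n m (N1 n j l) l = (\<Sum>p\<in>indices n. int (l p) * displacement m p)"
    unfolding shift_def floor_N R_def sum_indices displacement_def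
    by (simp add: sum_distrib_left sum_subtractf[symmetric] algebra_simps)
  ultimately show "multinom n (N1 n j l) l * coeff_prod n c l * f (i + shift n m (N1 n j l) l) =
      multinomial (indices n) l * (\<Prod>p\<in>indices n. c (fst p) (snd p) ^ l p) *
      f (i + (\<Sum>p\<in>indices n. int (l p) * displacement m p))"
    by simp
qed

lemma expansion2_0: "expansion2 n m c f i 0 = 0"
  unfolding expansion2_def I2_0 by simp

lemma expansion2_Suc: "expansion2 n m c f i (Suc j) = expansion1 n m c f i j"
  unfolding expansion1_def expansion2_def N2_Suc ..

lemma expansion1_0: "expansion1 n m c f i 0 = f i"
  unfolding expansion1_eq by (rule expansion_0) (simp_all add: level_weight_pos)

lemma expansion1_rec:
  assumes "j > 0"
  shows "expansion1 n m c f (i + m) j =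
    (\<Sum>s=1..2. \<Sum>r=1..n. if 3 - s \<le> j
       then c r s * expansion1 n m c f (i + (int r - 1)) (j - (3 - s)) else 0)"
  unfolding expansion1_eq sum_indices
  by (subst expansion_rec)
    (auto simp: level_weight_pos assms level_weight_def displacement_def algebra_simps intro!: sum.cong)

lemma atLeastAtMost_1_2: "{Suc 0..2} = {Suc 0, 2}"
  by auto

lemma expansion1_1: "expansion1 n m c f i 1 = (\<Sum>e=1..n. c e 2 * f (i + int e - 1 - m))"
  using expansion1_rec[of 1 n m c f "i - m"]
  by (simp add: atLeastAtMost_1_2 expansion1_0 algebra_simps)

lemma recurrent_expansion1: "recurrent n m c (expansion1 n m c f)"
  unfolding recurrent_def
  by (subst expansion1_rec) (simp_all add: atLeastAtMost_1_2)

text \<open>With the value \<open>0\<close> at level \<open>0\<close> the recurrence survives the delay by one level: at its first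
  step the summands with \<open>s = 1\<close> refer to level \<open>-1\<close> of the expansion without delay, and these
  are the summands that \<open>expansion1_rec\<close> leaves out.\<close>

lemma recurrent_expansion2: "recurrent n m c (expansion2 n m c f)"
  unfolding recurrent_def
proof (intro allI)
  fix i j
  show "expansion2 n m c f (i + m) (j + 2) =
      (\<Sum>s=1..2. \<Sum>r=1..n. c r s * expansion2 n m c f (i + (int r - 1)) (j + (s - 1)))"
  proof (cases j)
    case 0
    have "expansion2 n m c f (i + m) (j + 2) = expansion1 n m c f (i + m) 1"
      using expansion2_Suc[of n m c f "i + m" 1] 0 by (simp add: numeral_2_eq_2)
    then show ?thesis
      using expansion1_rec[of 1 n m c f i] 0
      by (simp add: atLeastAtMost_1_2 expansion2_0 expansion2_Suc)
  next
    case (Suc k)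
    have "expansion2 n m c f (i + m) (j + 2) = expansion1 n m c f (i + m) (k + 2)"
      using expansion2_Suc[of n m c f "i + m" "k + 2"] Suc by simp
    then show ?thesis
      using recurrent_expansion1[of n m c f, unfolded recurrent_def, rule_format, of i k] Suc
      by (simp add: atLeastAtMost_1_2 expansion2_Suc)
  qed
qed

section \<open>The explicit solution\<close>

lemma solves_ivp_explicit:
  "solves_ivp n m c \<Psi>0 \<Psi>1 (\<lambda>i j. expansion1 n m c \<Psi>0 i j + expansion2 n m c \<Psi>1 i j
     - (\<Sum>e=1..n. c e 2 * expansion2 n m c \<Psi>0 (i + (int e - 1 - m)) j))"
  (is "solves_ivp _ _ _ _ _ ?V")
proof -
  have "recurrent n m c ?V"
    by (intro recurrent_diff recurrent_add recurrent_sum recurrent_scale recurrent_expansion1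
        recurrent_expansion2 recurrent_translate[where X = "expansion2 n m c \<Psi>0"])
  moreover have "?V i 0 = \<Psi>0 i" for i
    by (simp add: expansion1_0 expansion2_0)
  moreover have "?V i 1 = \<Psi>1 i" for i
  proof -
    have "expansion2 n m c f i 1 = f i" for f i
      using expansion2_Suc[of n m c f i 0] by (simp add: expansion1_0)
    then show ?thesis
      unfolding expansion1_1 by (simp add: algebra_simps)
  qed
  ultimately show ?thesis
    unfolding solves_ivp_def recurrent_def by blast
qed

theorem theorem3p1:
  fixes n :: nat and m :: int and c :: "nat \<Rightarrow> nat \<Rightarrow> complex"
    and \<Psi>0 \<Psi>1 :: "int \<Rightarrow> complex" and U :: "int \<Rightarrow> nat \<Rightarrow> complex"
  assumes "n \<ge> 1"
  shows "solves_ivp n m c \<Psi>0 \<Psi>1 U \<longleftrightarrow>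
    (\<forall>i j. U i j =
        (\<Sum>l\<in>I1 n j. multinom n (N1 n j l) l * coeff_prod n c l * \<Psi>0 (i + shift n m (N1 n j l) l))
      + (\<Sum>l\<in>I2 n j. multinom n (N2 n j l) l * coeff_prod n c l * \<Psi>1 (i + shift n m (N2 n j l) l))
      - (\<Sum>e=1..n. c e 2 *
          (\<Sum>l\<in>I2 n j. multinom n (N2 n j l) l * coeff_prod n c l *
            \<Psi>0 (i + int e - 1 - m + shift n m (N2 n j l) l))))"
proof -
  let ?V = "\<lambda>i j. expansion1 n m c \<Psi>0 i j + expansion2 n m c \<Psi>1 i j
     - (\<Sum>e=1..n. c e 2 * expansion2 n m c \<Psi>0 (i + (int e - 1 - m)) j)"
  have "solves_ivp n m c \<Psi>0 \<Psi>1 U \<longleftrightarrow> (\<forall>i j. U i j = ?V i j)"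
  proof
    assume "solves_ivp n m c \<Psi>0 \<Psi>1 U"
    then show "\<forall>i j. U i j = ?V i j"
      using solves_ivp_unique[OF _ solves_ivp_explicit] by blast
  next
    assume "\<forall>i j. U i j = ?V i j"
    then have U: "U = ?V" by (intro ext) blast
    show "solves_ivp n m c \<Psi>0 \<Psi>1 U"
      unfolding U by (rule solves_ivp_explicit)
  qed
  then show ?thesis
    unfolding expansion1_def expansion2_def by (simp add: add_diff_eq)
qed

end
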